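(* Let $A$ be a commutative group (written multiplicatively) and let $n\geq 1$ be an integer. For $q\geq 0$ let $K(n)_q=A^{\binom{q}{n}}$, whose elements are written as families $(a_{u_1,\dots,u_n})_{0\leq u_1<\dots<u_n\leq q-1}$ (the trivial group if $q<n$), with componentwise multiplication. For $q\ge 1$ and $0\leq i\leq q$ define $\partial_i:K(n)_q\to K(n)_{q-1}$ by $\partial_i\big((a_{u_1,\dots,u_n})_{0\leq u_1<\dots<u_n\leq q-1}\big)=(b_{u_1,\dots,u_n})_{0\leq u_1<\dots<u_n\leq q-2}$, where $$b_{u_1,\dots,u_n}=\begin{cases} a_{u_1,\dots,u_n}\,a_{u_1,\dots,u_{n-1},i}^{(-1)^0}\,a_{u_1,\dots,u_{n-2},u_n,i}^{(-1)^1}\cdots a_{u_2,\dots,u_n,i}^{(-1)^{n-1}} & \text{if } u_n=i-1,\\ a_{d^i(u_1),\dots,d^i(u_n)} & \text{if } u_n\neq i-1.\end{cases}$$ (In the first case, the factors after $a_{u_1,\dots,u_n}$ are, for $j=0,\dots,n-1$, the element whose index is obtained from $(u_1,\dots,u_n,i)$ by deleting $u_{n-j}$, raised to the power $(-1)^j$.) For $q\ge 0$ and $0\leq i\leq q$ define $s_i:K(n)_q\to K(n)_{q+1}$ by $s_i\big((a_{u_1,\dots,u_n})_{0\leq u_1<\dots<u_n\leq q-1}\big)=(c_{u_1,\dots,u_n})_{0\leq u_1<\dots<u_n\leq q}$, where $$c_{u_1,\dots,u_n}=\begin{cases} 1 & \text{if } u_n=i,\\ a_{s^i(u_1),\dots,s^i(u_n)}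 & \text{if } u_n\neq i,\end{cases}$$ with the convention that $a_{s^i(u_1),\dots,s^i(u_n)}=1$ if two consecutive indices $s^i(u_j)$, $s^i(u_{j+1})$ are equal. Then $(K(n)_q,\partial_i,s_i)$ is a $K(A,n)$ simplicial group, i.e. it is a simplicial group whose homotopy groups satisfy $\pi_n\cong A$ and $\pi_m$ trivial for all $m\neq n$.
   Context: The maps $d^i,s^i$ on nonnegative integers are given by $d^i(u)=u$ if $u<i$, $d^i(u)=u+1$ if $u\geq i$; and $s^i(u)=u$ if $u\leq i$, $s^i(u)=u-1$ if $u>i$. A simplicial group consists of groups $X_q$, $q\geq 0$, with group morphisms $\partial_i:X_q\to X_{q-1}$ ($q\ge1$) and $s_i:X_q\to X_{q+1}$ for $0\leq i\leq q$, satisfying: $\partial_i\partial_j=\partial_{j-1}\partial_i$ if $i<j$; $s_is_j=s_{j+1}s_i$ if $i\leq j$; $\partial_is_j=s_{j-1}\partial_i$ if $i<j$; $\partial_js_j=\partial_{j+1}s_j=\mathrm{id}$; $\partial_is_j=s_j\partial_{i-1}$ if $i>j+1$. For a simplicial group $\mathbf{K}=(K_q,\partial_i,s_i)$ put $\overline{K}_q=K_q\cap \mathrm{Ker}(\partial_0)\cap\dots\cap \mathrm{Ker}(\partial_{q-1})$ (so $\overline{K}_0=K_0$). With differential $\partial_q:\overline{K}_q\to\overline{K}_{q-1}$ this is a chain complex, and the homotopy groups are $\pi_q(\mathbf{K})=H_q(\overline{\mathbf{K}})$. A $K(G,n)$ simplicial group (Eilenberg-MacLane simplicial group) is a simplicial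 group with $\pi_n\cong G$ and $\pi_m$ trivial for $m\neq n$. *)

theory Defs
  imports "HOL-Algebra.Product_Groups" "HOL-Algebra.FiniteProduct"
begin

section \<open>Simplicial groups and their homotopy groups\<close>

text \<open>
  All groups \<open>X q\<close> share one element type. The argument \<open>q\<close> of \<open>face q i\<close> and \<open>degen q i\<close> is the
  degree of the source, so \<open>face q i\<close> goes from degree \<open>q\<close> to degree \<open>q - 1\<close> (only \<open>q \<ge> 1\<close> is
  relevant) and \<open>degen q i\<close> from degree \<open>q\<close> to degree \<open>q + 1\<close>.
\<close>

locale simplicial_group =
  fixes X :: "nat \<Rightarrow> ('x, 'm) monoid_scheme"
    and face :: "nat \<Rightarrow> nat \<Rightarrow> 'x \<Rightarrow> 'x"
    and degen :: "nat \<Rightarrow> nat \<Rightarrow> 'x \<Rightarrow> 'x"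
  assumes group_X: "group (X q)"
    and face_hom: "q \<ge> 1 \<Longrightarrow> i \<le> q \<Longrightarrow> face q i \<in> hom (X q) (X (q - 1))"
    and degen_hom: "i \<le> q \<Longrightarrow> degen q i \<in> hom (X q) (X (q + 1))"
    and face_face:
      "q \<ge> 2 \<Longrightarrow> i < j \<Longrightarrow> j \<le> q \<Longrightarrow> x \<in> carrier (X q) \<Longrightarrow>
        face (q - 1) i (face q j x) = face (q - 1) (j - 1) (face q i x)"
    and degen_degen:
      "i \<le> j \<Longrightarrow> j \<le> q \<Longrightarrow> x \<in> carrier (X q) \<Longrightarrow>
        degen (q + 1) i (degen q j x) = degen (q + 1) (j + 1) (degen q i x)"
    and face_degen_less:
      "i < j \<Longrightarrow> j \<le> q \<Longrightarrow> x \<in> carrier (X q) \<Longrightarrow>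
        face (q + 1) i (degen q j x) = degen (q - 1) (j - 1) (face q i x)"
    and face_degen_same:
      "j \<le> q \<Longrightarrow> x \<in> carrier (X q) \<Longrightarrow> face (q + 1) j (degen q j x) = x"
    and face_degen_Suc:
      "j \<le> q \<Longrightarrow> x \<in> carrier (X q) \<Longrightarrow> face (q + 1) (j + 1) (degen q j x) = x"
    and face_degen_greater:
      "j + 1 < i \<Longrightarrow> i \<le> q + 1 \<Longrightarrow> x \<in> carrier (X q) \<Longrightarrow>
        face (q + 1) i (degen q j x) = degen (q - 1) j (face q (i - 1) x)"

definition moore_group ::
  "(nat \<Rightarrow> ('x, 'm) monoid_scheme) \<Rightarrow> (nat \<Rightarrow> nat \<Rightarrow> 'x \<Rightarrow> 'x) \<Rightarrow> nat \<Rightarrow> ('x, 'm) monoid_scheme"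
  where "moore_group X face q =
    (X q)\<lparr>carrier := carrier (X q) \<inter> (\<Inter>i<q. kernel (X q) (X (q - 1)) (face q i))\<rparr>"

text \<open>
  The differential out of degree \<open>0\<close> is trivial, so every element of degree \<open>0\<close> is a cycle.
\<close>

definition moore_cycles ::
  "(nat \<Rightarrow> ('x, 'm) monoid_scheme) \<Rightarrow> (nat \<Rightarrow> nat \<Rightarrow> 'x \<Rightarrow> 'x) \<Rightarrow> nat \<Rightarrow> 'x set"
  where "moore_cycles X face q =
    (if q = 0 then carrier (moore_group X face 0)
     else kernel (moore_group X face q) (moore_group X face (q - 1)) (face q q))"

definition moore_boundaries ::
  "(nat \<Rightarrow> ('x, 'm) monoid_scheme) \<Rightarrow> (nat \<Rightarrow> nat \<Rightarrow> 'x \<Rightarrow> 'x) \<Rightarrow> nat \<Rightarrow> 'x set"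
  where "moore_boundaries X face q = face (q + 1) (q + 1) ` carrier (moore_group X face (q + 1))"

definition homotopy_group ::
  "(nat \<Rightarrow> ('x, 'm) monoid_scheme) \<Rightarrow> (nat \<Rightarrow> nat \<Rightarrow> 'x \<Rightarrow> 'x) \<Rightarrow> nat \<Rightarrow> 'x set monoid"
  where "homotopy_group X face q =
    (moore_group X face q)\<lparr>carrier := moore_cycles X face q\<rparr> Mod moore_boundaries X face q"

definition EM_simplicial_group ::
  "('g, 'k) monoid_scheme \<Rightarrow> nat \<Rightarrow> (nat \<Rightarrow> ('x, 'm) monoid_scheme) \<Rightarrow>
    (nat \<Rightarrow> nat \<Rightarrow> 'x \<Rightarrow> 'x) \<Rightarrow> (nat \<Rightarrow> nat \<Rightarrow> 'x \<Rightarrow> 'x) \<Rightarrow> bool"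
  where "EM_simplicial_group G n X face degen \<longleftrightarrow>
    simplicial_group X face degen \<and>
    homotopy_group X face n \<cong> G \<and>
    (\<forall>m. m \<noteq> n \<longrightarrow> trivial_group (homotopy_group X face m))"

text \<open>
  The quotient in \<^const>\<open>homotopy_group\<close> is taken in the sense of \<^const>\<open>FactGroup\<close>, which does not
  itself demand normality; for a simplicial group the boundaries are normal in the cycles.
\<close>

context simplicial_group
begin

lemma moore_cycles_eq:
  "moore_cycles X face q =
    {x \<in> carrier (X q). \<forall>i\<le>q. q \<ge> 1 \<longrightarrow> face q i x = \<one>\<^bsub>X (q - 1)\<^esub>}"
  by (cases "q = 0") (auto simp: moore_cycles_def moore_group_def kernel_def le_less)

lemma moore_group_carrier:
  "carrier (moore_group X face q) =
    {x \<in> carrier (X q). \<forall>i<q. face q i x = \<one>\<^bsub>X (q - 1)\<^esub>}"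
  by (auto simp: moore_group_def kernel_def)

lemma face_group_hom: "q \<ge> 1 \<Longrightarrow> i \<le> q \<Longrightarrow> group_hom (X q) (X (q - 1)) (face q i)"
  using group_X face_hom by (simp add: group_hom_def group_hom_axioms_def)

lemma degen_group_hom: "i \<le> q \<Longrightarrow> group_hom (X q) (X (q + 1)) (degen q i)"
  using group_X degen_hom by (simp add: group_hom_def group_hom_axioms_def)

lemma moore_cycles_subgroup: "subgroup (moore_cycles X face q) (X q)"
proof -
  interpret group "X q" by (rule group_X)
  show ?thesis
  proof (rule subgroupI)
    show "moore_cycles X face q \<subseteq> carrier (X q)" by (auto simp: moore_cycles_eq)
    have "\<one>\<^bsub>X q\<^esub> \<in> moore_cycles X face q"
      by (auto simp: moore_cycles_eq group_hom.hom_one[OF face_group_hom])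
    then show "moore_cycles X face q \<noteq> {}" by blast
    show "inv\<^bsub>X q\<^esub> a \<in> moore_cycles X face q" if "a \<in> moore_cycles X face q" for a
      using that group_X[of "q - 1"]
      by (auto simp: moore_cycles_eq group_hom.hom_inv[OF face_group_hom]
          group.inv_equality[OF group_X] group.is_monoid[OF group_X] monoid.inv_one)
    show "a \<otimes>\<^bsub>X q\<^esub> b \<in> moore_cycles X face q"
      if "a \<in> moore_cycles X face q" "b \<in> moore_cycles X face q" for a b
      using that
      by (auto simp: moore_cycles_eq group_hom.hom_mult[OF face_group_hom]
          group.is_monoid[OF group_X] monoid.l_one)
  qed
qed

lemma moore_boundaries_subset: "moore_boundaries X face q \<subseteq> moore_cycles X face q"
proof
  fix b assume "b \<in> moore_boundaries X face q"
  then obtain y where y: "y \<in> carrier (X (q + 1))"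
    and y1: "\<And>i. i < q + 1 \<Longrightarrow> face (q + 1) i y = \<one>\<^bsub>X q\<^esub>"
    and b: "b = face (q + 1) (q + 1) y"
    by (auto simp: moore_boundaries_def moore_group_carrier)
  have "b \<in> carrier (X q)"
    using b y group_hom.hom_closed[OF face_group_hom[of "q + 1" "q + 1"]] by simp
  moreover have "face q i b = \<one>\<^bsub>X (q - 1)\<^esub>" if "i \<le> q" "q \<ge> 1" for i
  proof -
    have "face q i b = face q q (face (q + 1) i y)"
      using face_face[of "q + 1" i "q + 1" y] that y b by simp
    also have "\<dots> = \<one>\<^bsub>X (q - 1)\<^esub>"
      using that y1[of i] group_hom.hom_one[OF face_group_hom[of q q]] by simp
    finally show ?thesis .
  qed
  ultimately show "b \<in> moore_cycles X face q" by (auto simp: moore_cycles_eq)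
qed

lemma moore_boundaries_normal:
  "moore_boundaries X face q \<lhd> (moore_group X face q)\<lparr>carrier := moore_cycles X face q\<rparr>"
proof -
  let ?Z = "(X q)\<lparr>carrier := moore_cycles X face q\<rparr>"
  let ?B = "moore_boundaries X face q"
  let ?d = "face (Suc q) (Suc q)"
  interpret Q: group "X q" by (rule group_X)
  interpret S: group "X (Suc q)" by (rule group_X)
  have hom: "i \<le> Suc q \<Longrightarrow> group_hom (X (Suc q)) (X q) (face (Suc q) i)" for i
    using face_group_hom[of "Suc q" i] by simp
  interpret D: group_hom "X (Suc q)" "X q" ?d by (rule hom) simp
  interpret E: group_hom "X q" "X (Suc q)" "degen q q" using degen_group_hom[of q q] by simp
  have B: "?B = ?d ` {y \<in> carrier (X (Suc q)). \<forall>i<Suc q. face (Suc q) i y = \<one>\<^bsub>X q\<^esub>}"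
    by (simp add: moore_boundaries_def moore_group_carrier)
  have Z: "group ?Z"
    by (rule Q.subgroup_imp_group[OF moore_cycles_subgroup])
  have subB: "subgroup ?B (X q)"
  proof (rule Q.subgroupI)
    show "?B \<subseteq> carrier (X q)"
      using moore_boundaries_subset subgroup.subset[OF moore_cycles_subgroup] by (rule subset_trans)
    have "\<one>\<^bsub>X (Suc q)\<^esub> \<in> {y \<in> carrier (X (Suc q)). \<forall>i<Suc q. face (Suc q) i y = \<one>\<^bsub>X q\<^esub>}"
      using S.one_closed group_hom.hom_one[OF hom] by simp
    then show "?B \<noteq> {}" unfolding B by blast
    show "inv\<^bsub>X q\<^esub> a \<in> ?B" if "a \<in> ?B" for a
    proof -
      from that obtain y where y: "y \<in> carrier (X (Suc q))"
        "\<And>i. i < Suc q \<Longrightarrow> face (Suc q) i y = \<one>\<^bsub>X q\<^esub>" "a = ?d y"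
        by (auto simp: B)
      have "inv\<^bsub>X q\<^esub> a = ?d (inv\<^bsub>X (Suc q)\<^esub> y)" using y by simp
      moreover have "face (Suc q) i (inv\<^bsub>X (Suc q)\<^esub> y) = \<one>\<^bsub>X q\<^esub>" if "i < Suc q" for i
        using group_hom.hom_inv[OF hom, of i y] y that by simp
      ultimately show ?thesis unfolding B using y(1) by blast
    qed
    show "a \<otimes>\<^bsub>X q\<^esub> b \<in> ?B" if "a \<in> ?B" "b \<in> ?B" for a b
    proof -
      from that obtain y where y: "y \<in> carrier (X (Suc q))"
        "\<And>i. i < Suc q \<Longrightarrow> face (Suc q) i y = \<one>\<^bsub>X q\<^esub>" "a = ?d y"
        by (auto simp: B)
      from that obtain z where z: "z \<in> carrier (X (Suc q))"
        "\<And>i. i < Suc q \<Longrightarrow> face (Suc q) i z = \<one>\<^bsub>X q\<^esub>" "b = ?d z"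
        by (auto simp: B)
      have "a \<otimes>\<^bsub>X q\<^esub> b = ?d (y \<otimes>\<^bsub>X (Suc q)\<^esub> z)" using y z by simp
      moreover have "face (Suc q) i (y \<otimes>\<^bsub>X (Suc q)\<^esub> z) = \<one>\<^bsub>X q\<^esub>" if "i < Suc q" for i
        using group_hom.hom_mult[OF hom, of i y z] y z that by simp
      ultimately show ?thesis unfolding B using y(1) z(1) by blast
    qed
  qed
  have "subgroup ?B ?Z"
    by (rule Q.subgroup_incl[OF subB moore_cycles_subgroup moore_boundaries_subset])
  moreover have "x \<otimes>\<^bsub>?Z\<^esub> h \<otimes>\<^bsub>?Z\<^esub> inv\<^bsub>?Z\<^esub> x \<in> ?B" if x: "x \<in> carrier ?Z" and h: "h \<in> ?B" for x h
  proof -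
    have xX: "x \<in> carrier (X q)" using x by (auto simp: moore_cycles_eq)
    have inv: "inv\<^bsub>?Z\<^esub> x = inv\<^bsub>X q\<^esub> x"
      using Q.m_inv_consistent[OF moore_cycles_subgroup] x by simp
    from h obtain y where y: "y \<in> carrier (X (Suc q))"
      "\<And>i. i < Suc q \<Longrightarrow> face (Suc q) i y = \<one>\<^bsub>X q\<^esub>" "h = ?d y"
      by (auto simp: B)
    define w where "w = degen q q x"
    have w: "w \<in> carrier (X (Suc q))" "?d w = x"
      using xX face_degen_Suc[of q q x] E.hom_closed[OF xX] by (simp_all add: w_def)
    let ?y = "w \<otimes>\<^bsub>X (Suc q)\<^esub> y \<otimes>\<^bsub>X (Suc q)\<^esub> inv\<^bsub>X (Suc q)\<^esub> w"
    have "x \<otimes>\<^bsub>X q\<^esub> h \<otimes>\<^bsub>X q\<^esub> inv\<^bsub>X q\<^esub> x = ?d ?y" using w y by simp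
    moreover have "face (Suc q) i ?y = \<one>\<^bsub>X q\<^esub>" if "i < Suc q" for i
    proof -
      interpret F: group_hom "X (Suc q)" "X q" "face (Suc q) i" using that by (intro hom) simp
      show ?thesis using w y that by simp
    qed
    moreover have "?y \<in> carrier (X (Suc q))" using w(1) y(1) by simp
    ultimately have "x \<otimes>\<^bsub>X q\<^esub> h \<otimes>\<^bsub>X q\<^esub> inv\<^bsub>X q\<^esub> x \<in> ?B" unfolding B by blast
    then show ?thesis by (simp add: inv)
  qed
  ultimately have "?B \<lhd> ?Z"
    using group.normal_inv_iff[OF Z] by blast
  then show ?thesis by (simp add: moore_group_def)
qed

lemma group_homotopy_group: "group (homotopy_group X face q)"
  unfolding homotopy_group_def by (rule normal.factorgroup_is_group[OF moore_boundaries_normal])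

end


section \<open>The simplicial group $K(n)$\<close>

definition coface :: "nat \<Rightarrow> nat \<Rightarrow> nat"
  where "coface i u = (if u < i then u else u + 1)"

definition codegen :: "nat \<Rightarrow> nat \<Rightarrow> nat"
  where "codegen i u = (if u \<le> i then u else u - 1)"

text \<open>
  A multi-index \<open>0 \<le> u\<^sub>1 < \<dots> < u\<^sub>n \<le> q - 1\<close> is the list \<open>[u\<^sub>1, \<dots>, u\<^sub>n]\<close>; thus \<open>u\<^sub>j\<close> is \<open>u ! (j - 1)\<close>
  and \<open>u\<^sub>n\<close> is \<open>last u\<close>.
\<close>

definition multi_indices :: "nat \<Rightarrow> nat \<Rightarrow> nat list set"
  where "multi_indices n q = {u. length u = n \<and> sorted_wrt (<) u \<and> set u \<subseteq> {..<q}}"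

definition K_group :: "('a, 'b) monoid_scheme \<Rightarrow> nat \<Rightarrow> nat \<Rightarrow> (nat list \<Rightarrow> 'a) monoid"
  where "K_group A n q = product_group (multi_indices n q) (\<lambda>_. A)"

definition delete_nth :: "nat \<Rightarrow> 'c list \<Rightarrow> 'c list"
  where "delete_nth k w = take k w @ drop (Suc k) w"

text \<open>
  The condition \<open>u\<^sub>n = i - 1\<close> is an equation of integers (it never holds for \<open>i = 0\<close>), hence
  \<open>last u + 1 = i\<close> below. The entry \<open>u\<^sub>n\<^sub>-\<^sub>j\<close> to be deleted from \<open>(u\<^sub>1, \<dots>, u\<^sub>n, i)\<close> is at list
  position \<open>n - j - 1\<close>.
\<close>

definition K_face ::
  "('a, 'b) monoid_scheme \<Rightarrow> nat \<Rightarrow> nat \<Rightarrow> nat \<Rightarrow> (nat list \<Rightarrow> 'a) \<Rightarrow> (nat list \<Rightarrow> 'a)"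
  where "K_face A n q i a =
    (\<lambda>u\<in>multi_indices n (q - 1).
      if last u + 1 = i
      then a u \<otimes>\<^bsub>A\<^esub>
        (\<Otimes>\<^bsub>A\<^esub>j\<in>{..<n}. a (delete_nth (n - j - 1) (u @ [i])) [^]\<^bsub>A\<^esub> ((-1) ^ j :: int))
      else a (map (coface i) u))"

definition K_degen ::
  "('a, 'b) monoid_scheme \<Rightarrow> nat \<Rightarrow> nat \<Rightarrow> nat \<Rightarrow> (nat list \<Rightarrow> 'a) \<Rightarrow> (nat list \<Rightarrow> 'a)"
  where "K_degen A n q i a =
    (\<lambda>u\<in>multi_indices n (q + 1).
      if last u = i then \<one>\<^bsub>A\<^esub>
      else if \<not> distinct_adj (map (codegen i) u) then \<one>\<^bsub>A\<^esub>
      else a (map (codegen i) u))"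

end

theory Submission
  imports Defs
begin

text \<open>
  \<open>K(n)\<^sub>q\<close> is the group of normalized \<open>n\<close>-cocycles of the standard \<open>q\<close>-simplex in disguise: a family
  \<open>a\<close> corresponds to the cocycle \<open>z\<close> with \<open>a(u\<^sub>1, \<dots>, u\<^sub>n) = z(u\<^sub>1, \<dots>, u\<^sub>n, u\<^sub>n + 1)\<close>, and under this
  correspondence \<open>\<partial>\<^sub>i\<close> and \<open>s\<^sub>i\<close> become composition with \<open>d\<^sup>i\<close> and \<open>s\<^sup>i\<close> on the vertices. The simplicial
  identities are thus the (dual) identities between these maps. An index that skips a value
  \<open>i < u\<^sub>n\<close> lies in the image of \<open>d\<^sup>i\<close>, so an element of the Moore complex vanishes there; for
  \<open>q \<noteq> n\<close> this leaves at most the index \<open>(0, \<dots>, n - 1)\<close> with \<open>q > n\<close>, where \<open>\<partial>\<^sub>n\<close> forces the entry to be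
  trivial. Hence the Moore complex is \<open>A\<close> concentrated in degree \<open>n\<close>.
\<close>

section \<open>Deleting an entry of a list\<close>

lemma delete_nth_Cons:
  "delete_nth 0 (x # w) = w"
  "delete_nth (Suc k) (x # w) = x # delete_nth k w"
  by (simp_all add: delete_nth_def)

lemma delete_nth_append: "k < length u \<Longrightarrow> delete_nth k (u @ v) = delete_nth k u @ v"
  by (simp add: delete_nth_def)

text \<open>\<open>K_face\<close> counts deleted positions from the right end of a multi-index,
  whereas \<open>coboundary\<close> counts from the head of the reversed list.\<close>

lemma rev_delete_nth: "k < length u \<Longrightarrow> rev (delete_nth (length u - k - 1) u) = delete_nth k (rev u)"
  by (simp add: delete_nth_def take_rev drop_rev Suc_diff_Suc)

lemma length_delete_nth: "k < length u \<Longrightarrow> length (delete_nth k u) = length u - 1"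
  by (simp add: delete_nth_def)

lemma set_delete_nth_subset: "set (delete_nth k u) \<subseteq> set u"
  by (auto simp: delete_nth_def dest: in_set_takeD in_set_dropD)

lemma sorted_wrt_delete_nth: "sorted_wrt P u \<Longrightarrow> sorted_wrt P (delete_nth k u)"
proof (induction u arbitrary: k)
  case Nil
  then show ?case by (simp add: delete_nth_def)
next
  case (Cons x u)
  then show ?case
    using set_delete_nth_subset[of _ u] by (cases k) (auto simp: delete_nth_Cons)
qed

lemma nth_notin_delete_nth: "distinct u \<Longrightarrow> k < length u \<Longrightarrow> u ! k \<notin> set (delete_nth k u)"
proof (induction u arbitrary: k)
  case (Cons x u)
  then show ?case
    using set_delete_nth_subset[of _ u] by (cases k) (auto simp: delete_nth_Cons)
qed simp

section \<open>Cosimplicial identities for the vertex maps\<close>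

lemma coface_coface: "i < j \<Longrightarrow> coface j \<circ> coface i = coface i \<circ> coface (j - 1)"
  by (auto simp: coface_def fun_eq_iff)

lemma codegen_codegen: "i \<le> j \<Longrightarrow> codegen j \<circ> codegen i = codegen i \<circ> codegen (j + 1)"
  by (auto simp: codegen_def fun_eq_iff)

lemma codegen_coface_less: "i < j \<Longrightarrow> codegen j \<circ> coface i = coface i \<circ> codegen (j - 1)"
  by (auto simp: coface_def codegen_def fun_eq_iff)

lemma codegen_coface_same: "codegen j \<circ> coface j = id"
  by (auto simp: coface_def codegen_def fun_eq_iff)

lemma codegen_coface_Suc: "codegen j \<circ> coface (j + 1) = id"
  by (auto simp: coface_def codegen_def fun_eq_iff)

lemma codegen_coface_greater: "j + 1 < i \<Longrightarrow> codegen j \<circ> coface i = coface (i - 1) \<circ> codegen j"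
  by (auto simp: coface_def codegen_def fun_eq_iff)

lemma coface_codegen: "u \<noteq> i \<Longrightarrow> coface i (codegen i u) = u"
  by (auto simp: coface_def codegen_def)

section \<open>Multi-indices and their images under the vertex maps\<close>

lemma last_multi_index_less: "u \<in> multi_indices n q \<Longrightarrow> n \<ge> 1 \<Longrightarrow> last u < q"
  using last_in_set[of u] by (cases u) (auto simp: multi_indices_def)

lemma multi_index_le_last: "u \<in> multi_indices n q \<Longrightarrow> x \<in> set u \<Longrightarrow> x \<le> last u"
  by (cases u rule: rev_cases) (auto simp: multi_indices_def sorted_wrt_append)

lemma map_coface_multi_index:
  "u \<in> multi_indices n (q - 1) \<Longrightarrow> q \<ge> 1 \<Longrightarrow> map (coface i) u \<in> multi_indices n q"
  by (fastforce simp: multi_indices_def coface_def sorted_wrt_map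
      intro: sorted_wrt_mono_rel[rotated])

lemma sorted_distinct_adj_imp_strict:
  fixes u :: "'c :: linorder list"
  assumes "sorted u" "distinct_adj u"
  shows "sorted_wrt (<) u"
  using assms
proof (induction u)
  case (Cons x u)
  then show ?case by (cases u) (auto simp: distinct_adj_Cons)
qed simp

text \<open>\<open>codegen i\<close> is monotone, so only repetitions can spoil strictness. The
  value \<open>q\<close> could be attained only if \<open>i = q\<close> and \<open>q\<close> occurs
  in \<open>u\<close>, that is, if \<open>last u = i\<close>.\<close>

lemma map_codegen_multi_index:
  assumes u: "u \<in> multi_indices n (q + 1)" and "i \<le> q" "last u \<noteq> i"
    and "distinct_adj (map (codegen i) u)"
  shows "map (codegen i) u \<in> multi_indices n q"
proof -
  have "sorted (map (codegen i) u)"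
    unfolding sorted_map
  proof (rule sorted_wrt_mono_rel[rotated])
    show "sorted_wrt (<) u" using u by (simp add: multi_indices_def)
  qed (auto simp: codegen_def)
  from this assms(4) have "sorted_wrt (<) (map (codegen i) u)"
    by (rule sorted_distinct_adj_imp_strict)
  moreover have "codegen i x < q" if "x \<in> set u" for x
    using that multi_index_le_last[OF u that] u assms(2,3) last_in_set[of u]
    by (fastforce simp: multi_indices_def codegen_def)
  ultimately show ?thesis using u by (auto simp: multi_indices_def)
qed

lemma multi_indices_empty:
  assumes "q < n"
  shows "multi_indices n q = {}"
proof -
  have "n \<le> q" if "u \<in> multi_indices n q" for u
  proof -
    have u: "sorted_wrt (<) u" "length u = n" "set u \<subseteq> {..<q}"
      using that by (auto simp: multi_indices_def)
    then have "card (set u) = n" by (simp add: strict_sorted_iff distinct_card)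
    then show ?thesis using card_mono[of "{..<q}" "set u"] u(3) by simp
  qed
  then show ?thesis using assms by fastforce
qed

lemma multi_indices_self: "multi_indices n n = {[0..<n]}"
proof -
  have "u = [0..<n]" if "u \<in> multi_indices n n" for u
  proof -
    have s: "sorted u" "distinct u" "set u \<subseteq> {..<n}" "length u = n"
      using that by (auto simp: multi_indices_def strict_sorted_iff)
    then have "card (set u) = card {..<n}" by (simp add: distinct_card)
    then have "set u = {..<n}" using s(3) by (intro card_subset_eq) auto
    then have "set u = set [0..<n]" by (simp add: lessThan_atLeast0)
    then show ?thesis by (intro sorted_distinct_set_unique s(1,2) sorted_upt distinct_upt)
  qed
  moreover have "[0..<n] \<in> multi_indices n n"
    by (auto simp: multi_indices_def)
  ultimately show ?thesis by blast
qed

section \<open>Cochains and coboundaries\<close>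

context comm_group
begin

text \<open>
  Cochains are functions on arbitrary vertex lists, to be read as listed in decreasing order (the
  reverse of a multi-index). The recursion expands the alternating product
  \<open>\<Prod>\<^sub>j z(w without its j-th entry)^((-1)^j)\<close>.
\<close>

fun coboundary :: "('c list \<Rightarrow> 'a) \<Rightarrow> 'c list \<Rightarrow> 'a" where
  "coboundary z [] = \<one>"
| "coboundary z (x # w) = z w \<otimes> inv (coboundary (\<lambda>v. z (x # v)) w)"

lemma coboundary_closed [simp]:
  "(\<And>w. z w \<in> carrier G) \<Longrightarrow> coboundary z w \<in> carrier G"
  by (induction z w rule: coboundary.induct) auto

lemma coboundary_one: "coboundary (\<lambda>_. \<one>) w = \<one>"
  by (induction w) auto

lemma coboundary_mult:
  assumes "\<And>w. z w \<in> carrier G" "\<And>w. z' w \<in> carrier G"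
  shows "coboundary (\<lambda>v. z v \<otimes> z' v) w = coboundary z w \<otimes> coboundary z' w"
  using assms
proof (induction w arbitrary: z z')
  case (Cons x w)
  then show ?case by (simp add: inv_mult m_ac)
qed simp

lemma coboundary_inv:
  assumes "\<And>w. z w \<in> carrier G"
  shows "coboundary (\<lambda>v. inv (z v)) w = inv (coboundary z w)"
  using assms
proof (induction w arbitrary: z)
  case (Cons x w)
  then show ?case by (simp add: inv_mult)
qed simp

text \<open>Splitting off the head \<open>x\<close>, the two terms \<open>coboundary z w\<close>
  cancel; what remains is the double coboundary of \<open>\<lambda>v. z (x # v)\<close> at
  \<open>w\<close>, trivial by induction.\<close>

lemma coboundary_coboundary:
  assumes "\<And>w. z w \<in> carrier G"
  shows "coboundary (coboundary z) w = \<one>"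
  using assms
proof (induction w arbitrary: z)
  case (Cons x w)
  then show ?case
    by (simp add: coboundary_mult coboundary_inv inv_mult)
qed simp

lemma coboundary_comp_map: "coboundary (z \<circ> map f) w = coboundary z (map f w)"
proof (induction w arbitrary: z)
  case (Cons x w)
  from this[of "\<lambda>v. z (f x # v)"] show ?case by (simp add: comp_def)
qed simp

text \<open>If the only repetition is at the head, \<open>w = x # x # w'\<close>, the first two
  terms are equal with opposite signs and all later ones still contain the pair \<open>x, x\<close>.
  Otherwise the tail keeps a repetition and induction applies.\<close>

lemma coboundary_normalized:
  assumes "\<And>w. z w \<in> carrier G" "\<And>w. \<not> distinct_adj w \<Longrightarrow> z w = \<one>"
    and "\<not> distinct_adj w"
  shows "coboundary z w = \<one>"
  using assms
proof (induction w arbitrary: z)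
  case (Cons x w)
  show ?case
  proof (cases "distinct_adj w")
    case True
    with Cons.prems(3) obtain w' where "w = x # w'"
      by (auto simp: distinct_adj_Cons neq_Nil_conv)
    then show ?thesis using Cons.prems(1,2) by (simp add: coboundary_one)
  next
    case False
    moreover have "coboundary (\<lambda>v. z (x # v)) w = \<one>"
      using Cons.prems False by (intro Cons.IH) (auto dest: distinct_adj_ConsD)
    ultimately show ?thesis using Cons.prems by simp
  qed
qed simp

lemma finprod_inv:
  assumes "f \<in> A \<rightarrow> carrier G"
  shows "(\<Otimes>i\<in>A. inv (f i)) = inv (finprod G f A)"
  using assms by (induction A rule: infinite_finite_induct) (auto simp: inv_mult Pi_iff)

text \<open>Unrolls the recursion into the indexed product used by \<open>K_face\<close>; the nested
  inverses become the signs \<open>(-1) ^ j\<close>.\<close>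

lemma coboundary_eq_finprod:
  assumes "\<And>w. z w \<in> carrier G"
  shows "coboundary z w = (\<Otimes>j\<in>{..<length w}. z (delete_nth j w) [^] ((-1) ^ j :: int))"
  using assms
proof (induction w arbitrary: z)
  case (Cons x w)
  let ?f = "\<lambda>j. z (delete_nth j (x # w)) [^] ((-1) ^ j :: int)"
  have "(\<Otimes>j\<in>{..<length (x # w)}. ?f j) = ?f 0 \<otimes> (\<Otimes>j\<in>{..<length w}. ?f (Suc j))"
    using Cons.prems
    by (simp add: lessThan_Suc_eq_insert_0 finprod_insert finprod_reindex del: power_Suc)
  also have "(\<Otimes>j\<in>{..<length w}. ?f (Suc j)) =
      inv (\<Otimes>j\<in>{..<length w}. z (x # delete_nth j w) [^] ((-1) ^ j :: int))"
    using Cons.prems by (simp add: delete_nth_Cons int_pow_neg finprod_inv)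
  finally show ?case using Cons by (simp add: delete_nth_Cons)
qed simp

section \<open>Normalized cocycles and their entries\<close>

definition normalized_cocycle :: "('c list \<Rightarrow> 'a) \<Rightarrow> bool" where
  "normalized_cocycle z \<longleftrightarrow> (\<forall>w. z w \<in> carrier G) \<and>
    (\<forall>w. \<not> distinct_adj w \<longrightarrow> z w = \<one>) \<and> (\<forall>w. coboundary z w = \<one>)"

lemma normalized_cocycle_coboundary:
  assumes "\<And>w. z w \<in> carrier G" "\<And>w. \<not> distinct_adj w \<Longrightarrow> z w = \<one>"
  shows "normalized_cocycle (coboundary z)"
  using assms by (simp add: normalized_cocycle_def coboundary_coboundary coboundary_normalized)

lemma normalized_cocycle_comp_map:
  "normalized_cocycle z \<Longrightarrow> normalized_cocycle (z \<circ> map f)"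
  by (auto simp: normalized_cocycle_def coboundary_comp_map dest: distinct_adj_mapD)

lemma normalized_cocycle_mult:
  "normalized_cocycle z \<Longrightarrow> normalized_cocycle z' \<Longrightarrow> normalized_cocycle (\<lambda>w. z w \<otimes> z' w)"
  by (auto simp: normalized_cocycle_def coboundary_mult)

text \<open>\<open>z\<close> lives on vertex lists of every length; \<open>n\<close> and
  \<open>q\<close> enter only here, so composing with a vertex map involves no change of domain.
  Outside the multi-indices the value is \<open>undefined\<close>, as in the carrier of
  \<open>K_group\<close>.\<close>

definition cocycle_entries :: "nat \<Rightarrow> nat \<Rightarrow> (nat list \<Rightarrow> 'a) \<Rightarrow> nat list \<Rightarrow> 'a" where
  "cocycle_entries n q z = (\<lambda>u\<in>multi_indices n q. z (Suc (last u) # rev u))"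

lemma cocycle_entries_closed:
  "normalized_cocycle z \<Longrightarrow> cocycle_entries n q z \<in> carrier (K_group G n q)"
  by (auto simp: cocycle_entries_def K_group_def normalized_cocycle_def)

lemma cocycle_entries_mult:
  "cocycle_entries n q (\<lambda>w. z w \<otimes> z' w) =
    cocycle_entries n q z \<otimes>\<^bsub>K_group G n q\<^esub> cocycle_entries n q z'"
  by (auto simp: cocycle_entries_def K_group_def)

lemma cocycle_entries_surj:
  assumes a: "a \<in> carrier (K_group G n q)" and "n \<ge> 1"
  obtains z where "normalized_cocycle z" "a = cocycle_entries n q z"
proof -
  text \<open>With \<open>c\<close> the inverse of a sum function of \<open>a\<close> in the last vertex, the coboundary of \<open>c\<close> at
    \<open>(u\<^sub>1, \<dots>, u\<^sub>n, u\<^sub>n + 1)\<close> telescopes to \<open>a(u\<^sub>1, \<dots>, u\<^sub>n)\<close>.\<close>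
  define b where "b w = (if rev w \<in> multi_indices n q then a (rev w) else \<one>)" for w
  define c where "c w = inv (\<Otimes>x\<in>{..<hd w}. b (x # tl w))" for w
  have b: "b w \<in> carrier G" for w
    using a by (auto simp: b_def K_group_def)
  have b1: "b w = \<one>" if "\<not> sorted_wrt (>) w" for w
    using that by (auto simp: b_def multi_indices_def sorted_wrt_rev)
  have c: "c w \<in> carrier G" for w
    using b by (simp add: c_def)
  have c_one: "c (v # w) = \<one>" if "\<And>x. x < v \<Longrightarrow> \<not> sorted_wrt (>) (x # w)" for v w
  proof -
    have "b (x # w) = \<one>" if "x \<in> {..<v}" for x
      using that b1 \<open>\<And>x. x < v \<Longrightarrow> \<not> sorted_wrt (>) (x # w)\<close> by blast
    then have "(\<Otimes>x\<in>{..<v}. b (x # w)) = \<one>" by (rule finprod_one_eqI)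
    then show ?thesis by (simp add: c_def)
  qed
  have "c w = \<one>" if nd: "\<not> distinct_adj w" for w
  proof -
    obtain v w' where w: "w = v # w'" using nd by (cases w) auto
    \<comment> \<open>Otherwise \<open>w'\<close> has no repetition, so the one in
      \<open>v # w'\<close> is at the head: \<open>v = hd w'\<close>, and then
      \<open>x > hd w' = v > x\<close>.\<close>
    have "\<not> sorted_wrt (>) (x # w')" if "x < v" for x
    proof
      assume s: "sorted_wrt (>) (x # w')"
      have "distinct_adj w'"
        using s by (induction w') (auto simp: distinct_adj_Cons)
      with s that nd show False
        by (auto simp: w distinct_adj_Cons neq_Nil_conv)
    qed
    then show ?thesis unfolding w by (rule c_one)
  qed
  then have "normalized_cocycle (coboundary c)"
    using c by (intro normalized_cocycle_coboundary)
  moreover have "a = cocycle_entries n q (coboundary c)"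
  proof
    fix u
    show "a u = cocycle_entries n q (coboundary c) u"
    proof (cases "u \<in> multi_indices n q")
      case True
      then have "rev u \<noteq> []" using \<open>n \<ge> 1\<close> by (auto simp: multi_indices_def)
      then obtain l r where lr: "rev u = l # r" by (cases "rev u") auto
      then have u: "u = rev r @ [l]" by (simp add: rev_swap)
      \<comment> \<open>No \<open>x < Suc l\<close> exceeds \<open>l\<close>, so every factor of the
        product is trivial; only the first two terms of the coboundary survive.\<close>
      have "(\<lambda>v. c (Suc l # l # v)) = (\<lambda>_. \<one>)"
        by (rule ext, rule c_one) auto
      moreover have "c (Suc l # r) = c (l # r) \<otimes> inv (b (l # r))"
        using b by (simp add: c_def lessThan_Suc inv_mult m_comm)
      ultimately have "coboundary c (Suc l # l # r) = b (l # r)"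
        using b c by (simp add: coboundary_one inv_mult m_assoc[symmetric])
      then show ?thesis
        using True lr u by (simp add: cocycle_entries_def b_def)
    next
      case False
      then show ?thesis using a by (auto simp: cocycle_entries_def K_group_def)
    qed
  qed
  ultimately show ?thesis by (rule that)
qed

section \<open>Faces and degeneracies as composition with vertex maps\<close>

text \<open>The exceptional case of the face map is the cocycle condition on the vertices
  \<open>u\<^sub>1, \<dots>, u\<^sub>n, i, i + 1\<close>, solved for the value on \<open>u\<^sub>1, \<dots>, u\<^sub>n, i + 1\<close>.\<close>

lemma K_face_cocycle_entries:
  assumes z: "normalized_cocycle z" and "n \<ge> 1" "q \<ge> 1"
  shows "K_face G n q i (cocycle_entries n q z) = cocycle_entries n (q - 1) (z \<circ> map (coface i))"
proof
  fix u
  have zc: "z w \<in> carrier G" for w using z by (simp add: normalized_cocycle_def)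
  show "K_face G n q i (cocycle_entries n q z) u = cocycle_entries n (q - 1) (z \<circ> map (coface i)) u"
  proof (cases "u \<in> multi_indices n (q - 1)")
    case u: True
    then have len: "length u = n" and ne: "u \<noteq> []" and s: "sorted_wrt (<) u"
      using \<open>n \<ge> 1\<close> by (auto simp: multi_indices_def)
    have l: "last u < q - 1" using u \<open>n \<ge> 1\<close> by (rule last_multi_index_less)
    have le: "x \<le> last u" if "x \<in> set u" for x using u that by (rule multi_index_le_last)
    show ?thesis
    proof (cases "last u + 1 = i")
      case True
      let ?a = "cocycle_entries n q z"
      have uq: "u \<in> multi_indices n q" using u by (auto simp: multi_indices_def)
      have ui: "u @ [i] \<in> multi_indices (Suc n) q"
        using u l le True by (auto simp: multi_indices_def sorted_wrt_append less_Suc_eq_le)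
      \<comment> \<open>The deleted position lies inside \<open>u\<close>, so \<open>i\<close> stays
        the last entry and the extra vertex supplied by \<open>cocycle_entries\<close> is
        \<open>Suc i\<close>.\<close>
      have entry: "?a (delete_nth (n - j - 1) (u @ [i])) = z (Suc i # i # delete_nth j (rev u))"
        if "j < n" for j
      proof -
        have "n - j - 1 < length u" using that len by simp
        moreover have "delete_nth (n - j - 1) (u @ [i]) \<in> multi_indices n q"
          using ui len set_delete_nth_subset[of "n - j - 1" "u @ [i]"]
          by (auto simp: multi_indices_def length_delete_nth sorted_wrt_delete_nth)
        ultimately show ?thesis
          using that len rev_delete_nth[of j u]
          by (simp add: cocycle_entries_def delete_nth_append)
      qed
      have "K_face G n q i ?a u =
          ?a u \<otimes> (\<Otimes>j\<in>{..<n}. ?a (delete_nth (n - j - 1) (u @ [i])) [^] ((-1) ^ j :: int))"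
        using u True by (simp add: K_face_def)
      also have "\<dots> = z (i # rev u) \<otimes> coboundary (\<lambda>v. z (Suc i # i # v)) (rev u)"
        using entry zc uq True len
        by (simp add: coboundary_eq_finprod cocycle_entries_def cong: finprod_cong)
      also have "\<dots> = z (Suc i # rev u)"
      proof -
        let ?d = "coboundary (\<lambda>v. z (Suc i # i # v)) (rev u)"
        have "coboundary z (Suc i # i # rev u) = \<one>"
          using z unfolding normalized_cocycle_def by blast
        then have "z (i # rev u) \<otimes> ?d \<otimes> inv (z (Suc i # rev u)) = \<one>"
          using zc by (simp add: inv_mult m_ac)
        then show ?thesis using zc by (metis coboundary_closed inv_closed inv_equality inv_inv m_closed)
      qed
      also have "\<dots> = (z \<circ> map (coface i)) (Suc (last u) # rev u)"
      proof -
        \<comment> \<open>All entries of \<open>u\<close> lie below \<open>i\<close>; only the extra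
          vertex \<open>i = Suc (last u)\<close> moves, to \<open>Suc i\<close>.\<close>
        have "map (coface i) (rev u) = rev u"
          using le True by (intro map_idI) (fastforce simp: coface_def)
        then show ?thesis using True by (simp add: coface_def)
      qed
      finally show ?thesis using u by (simp add: cocycle_entries_def)
    next
      case False
      \<comment> \<open>\<open>coface i\<close> separates two consecutive vertices only when the
        upper one is \<open>i\<close>, which is the excluded case.\<close>
      then have "coface i (Suc (last u)) = Suc (coface i (last u))" by (auto simp: coface_def)
      then show ?thesis
        using False u ne map_coface_multi_index[OF u \<open>q \<ge> 1\<close>]
        by (simp add: K_face_def cocycle_entries_def last_map rev_map)
    qed
  qed (simp add: K_face_def cocycle_entries_def)
qed

text \<open>Both default values \<open>\<one>\<close> are instances of normalization: for
  \<open>last u = i\<close> the vertices \<open>i\<close> and \<open>i + 1\<close> collapse, and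
  otherwise a repetition already occurs within the image of \<open>u\<close>. In the remaining case
  \<open>codegen i\<close> keeps \<open>last u\<close> and its successor consecutive.\<close>

lemma K_degen_cocycle_entries:
  assumes z: "normalized_cocycle z" and "n \<ge> 1" "i \<le> q"
  shows "K_degen G n q i (cocycle_entries n q z) = cocycle_entries n (q + 1) (z \<circ> map (codegen i))"
proof
  fix u
  have z1: "z w = \<one>" if "\<not> distinct_adj w" for w
    using z that by (simp add: normalized_cocycle_def)
  show "K_degen G n q i (cocycle_entries n q z) u =
    cocycle_entries n (q + 1) (z \<circ> map (codegen i)) u"
  proof (cases "u \<in> multi_indices n (q + 1)")
    case u: True
    then have ne: "u \<noteq> []" using \<open>n \<ge> 1\<close> by (auto simp: multi_indices_def)
    consider "last u = i" | "last u \<noteq> i" "\<not> distinct_adj (map (codegen i) u)"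
      | "last u \<noteq> i" "distinct_adj (map (codegen i) u)" by blast
    then show ?thesis
    proof cases
      case 1
      have "rev u = last u # rev (butlast u)"
        using ne by (metis append_butlast_last_id rev_eq_Cons_iff rev_rev_ident)
      then have "z (map (codegen i) (Suc (last u) # rev u)) = \<one>"
        using 1 by (intro z1) (simp only:, simp add: codegen_def)
      then show ?thesis using 1 u by (simp add: K_degen_def cocycle_entries_def)
    next
      case 2
      have "z (map (codegen i) (Suc (last u) # rev u)) = \<one>"
        using 2 by (intro z1) (auto simp flip: rev_map dest: distinct_adj_ConsD)
      then show ?thesis using 2 u by (simp add: K_degen_def cocycle_entries_def)
    next
      case 3
      then have "codegen i (Suc (last u)) = Suc (codegen i (last u))" by (auto simp: codegen_def)
      then show ?thesis
        using 3 u ne map_codegen_multi_index[OF u \<open>i \<le> q\<close> 3]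
        by (simp add: K_degen_def cocycle_entries_def last_map rev_map)
    qed
  qed (simp add: K_degen_def cocycle_entries_def)
qed

section \<open>The simplicial group laws\<close>

lemma group_K_group: "group (K_group G n q)"
  unfolding K_group_def by (simp add: is_group)

text \<open>Every law is checked after lifting its arguments to cocycles: products become pointwise
  products, and composites of operators become composites of vertex maps in the opposite
  order.\<close>

lemma simplicial_group_K:
  assumes n: "n \<ge> 1"
  shows "simplicial_group (K_group G n) (K_face G n) (K_degen G n)"
proof (rule simplicial_group.intro)
  show "group (K_group G n q)" for q by (rule group_K_group)
next
  fix q i :: nat
  assume q: "q \<ge> 1" and i: "i \<le> q"
  show "K_face G n q i \<in> hom (K_group G n q) (K_group G n (q - 1))"
  proof (rule homI)
    fix x assume "x \<in> carrier (K_group G n q)"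
    then obtain z where "normalized_cocycle z" "x = cocycle_entries n q z"
      using n by (rule cocycle_entries_surj)
    then show "K_face G n q i x \<in> carrier (K_group G n (q - 1))"
      using n q by (simp add: K_face_cocycle_entries cocycle_entries_closed normalized_cocycle_comp_map)
  next
    fix x y assume "x \<in> carrier (K_group G n q)" "y \<in> carrier (K_group G n q)"
    then obtain z z' where z: "normalized_cocycle z" "x = cocycle_entries n q z"
      and z': "normalized_cocycle z'" "y = cocycle_entries n q z'"
      using n by (metis cocycle_entries_surj)
    have "K_face G n q i (x \<otimes>\<^bsub>K_group G n q\<^esub> y)
        = cocycle_entries n (q - 1) ((\<lambda>w. z w \<otimes> z' w) \<circ> map (coface i))"
      using K_face_cocycle_entries[OF normalized_cocycle_mult[OF z(1) z'(1)] n q] z(2) z'(2)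
      by (simp flip: cocycle_entries_mult)
    also have "\<dots> = K_face G n q i x \<otimes>\<^bsub>K_group G n (q - 1)\<^esub> K_face G n q i y"
      using z z' n q by (simp add: K_face_cocycle_entries comp_def flip: cocycle_entries_mult)
    finally show "K_face G n q i (x \<otimes>\<^bsub>K_group G n q\<^esub> y)
        = K_face G n q i x \<otimes>\<^bsub>K_group G n (q - 1)\<^esub> K_face G n q i y" .
  qed
next
  fix q i :: nat
  assume i: "i \<le> q"
  show "K_degen G n q i \<in> hom (K_group G n q) (K_group G n (q + 1))"
  proof (rule homI)
    fix x assume "x \<in> carrier (K_group G n q)"
    then obtain z where "normalized_cocycle z" "x = cocycle_entries n q z"
      using n by (rule cocycle_entries_surj)
    then show "K_degen G n q i x \<in> carrier (K_group G n (q + 1))"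
      using n i K_degen_cocycle_entries[of z n i q]
      by (simp add: cocycle_entries_closed normalized_cocycle_comp_map)
  next
    fix x y assume "x \<in> carrier (K_group G n q)" "y \<in> carrier (K_group G n q)"
    then obtain z z' where z: "normalized_cocycle z" "x = cocycle_entries n q z"
      and z': "normalized_cocycle z'" "y = cocycle_entries n q z'"
      using n by (metis cocycle_entries_surj)
    have "K_degen G n q i (x \<otimes>\<^bsub>K_group G n q\<^esub> y)
        = cocycle_entries n (q + 1) ((\<lambda>w. z w \<otimes> z' w) \<circ> map (codegen i))"
      using K_degen_cocycle_entries[OF normalized_cocycle_mult[OF z(1) z'(1)] n i] z(2) z'(2)
      by (simp flip: cocycle_entries_mult)
    also have "\<dots> = K_degen G n q i x \<otimes>\<^bsub>K_group G n (q + 1)\<^esub> K_degen G n q i y"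
      using z z' K_degen_cocycle_entries[OF _ n i]
      by (simp add: comp_def flip: cocycle_entries_mult)
    finally show "K_degen G n q i (x \<otimes>\<^bsub>K_group G n q\<^esub> y)
        = K_degen G n q i x \<otimes>\<^bsub>K_group G n (q + 1)\<^esub> K_degen G n q i y" .
  qed
next
  fix q i j :: nat and x
  assume *: "q \<ge> 2" "i < j" "j \<le> q" "x \<in> carrier (K_group G n q)"
  from *(4) n obtain z where z: "normalized_cocycle z" "x = cocycle_entries n q z"
    by (rule cocycle_entries_surj)
  with * n show "K_face G n (q - 1) i (K_face G n q j x) = K_face G n (q - 1) (j - 1) (K_face G n q i x)"
    by (simp add: K_face_cocycle_entries normalized_cocycle_comp_map comp_assoc map_comp_map
        coface_coface del: One_nat_def)
next
  fix q i j :: nat and x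
  assume *: "i \<le> j" "j \<le> q" "x \<in> carrier (K_group G n q)"
  from *(3) n obtain z where z: "normalized_cocycle z" "x = cocycle_entries n q z"
    by (rule cocycle_entries_surj)
  with * n show "K_degen G n (q + 1) i (K_degen G n q j x) = K_degen G n (q + 1) (j + 1) (K_degen G n q i x)"
    by (simp add: K_degen_cocycle_entries normalized_cocycle_comp_map comp_assoc map_comp_map
        codegen_codegen del: add_Suc_right Suc_eq_plus1 add_2_eq_Suc')
next
  fix q i j :: nat and x
  assume *: "i < j" "j \<le> q" "x \<in> carrier (K_group G n q)"
  from *(3) n obtain z where z: "normalized_cocycle z" "x = cocycle_entries n q z"
    by (rule cocycle_entries_surj)
  \<comment> \<open>Here \<open>i < j \<le> q\<close> forces \<open>q \<ge> 1\<close>, so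
    \<open>q - 1 + 1 = q\<close> despite truncated subtraction.\<close>
  have "K_degen G n (q - 1) (j - 1) (K_face G n q i x) =
      cocycle_entries n q (z \<circ> map (coface i) \<circ> map (codegen (j - 1)))"
    using z * n K_degen_cocycle_entries[of "z \<circ> map (coface i)" n "j - 1" "q - 1"]
    by (simp add: K_face_cocycle_entries normalized_cocycle_comp_map)
  with z * n show "K_face G n (q + 1) i (K_degen G n q j x) = K_degen G n (q - 1) (j - 1) (K_face G n q i x)"
    using K_degen_cocycle_entries[of z n j q] K_face_cocycle_entries[of "z \<circ> map (codegen j)" n "q + 1" i]
    by (simp add: normalized_cocycle_comp_map comp_assoc map_comp_map codegen_coface_less)
next
  fix q j :: nat and x
  assume *: "j \<le> q" "x \<in> carrier (K_group G n q)"
  from *(2) n obtain z where z: "normalized_cocycle z" "x = cocycle_entries n q z"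
    by (rule cocycle_entries_surj)
  have "K_face G n (q + 1) i (K_degen G n q j x) = cocycle_entries n q (z \<circ> map (codegen j \<circ> coface i))" for i
    using z * n K_degen_cocycle_entries[of z n j q] K_face_cocycle_entries[of "z \<circ> map (codegen j)" n "q + 1" i]
    by (simp add: normalized_cocycle_comp_map comp_assoc map_comp_map)
  from this[of j] this[of "j + 1"]
  show "K_face G n (q + 1) j (K_degen G n q j x) = x" "K_face G n (q + 1) (j + 1) (K_degen G n q j x) = x"
    using z(2) codegen_coface_same[of j] codegen_coface_Suc[of j] by simp_all
next
  fix q i j :: nat and x
  assume *: "j + 1 < i" "i \<le> q + 1" "x \<in> carrier (K_group G n q)"
  from *(3) n obtain z where z: "normalized_cocycle z" "x = cocycle_entries n q z"
    by (rule cocycle_entries_surj)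
  have "K_degen G n (q - 1) j (K_face G n q (i - 1) x) =
      cocycle_entries n q (z \<circ> map (coface (i - 1)) \<circ> map (codegen j))"
    using z * n K_degen_cocycle_entries[of "z \<circ> map (coface (i - 1))" n j "q - 1"]
    by (simp add: K_face_cocycle_entries normalized_cocycle_comp_map)
  with z * n show "K_face G n (q + 1) i (K_degen G n q j x) = K_degen G n (q - 1) j (K_face G n q (i - 1) x)"
    using K_degen_cocycle_entries[of z n j q] K_face_cocycle_entries[of "z \<circ> map (codegen j)" n "q + 1" i]
    by (simp add: normalized_cocycle_comp_map comp_assoc map_comp_map codegen_coface_greater)
qed

section \<open>The Moore complex of \<open>K_group\<close>\<close>

lemma moore_entry_one:
  assumes a: "a \<in> carrier (moore_group (K_group G n) (K_face G n) q)"
    and u: "u \<in> multi_indices n q" and n: "n \<ge> 1" and i: "i < last u" "i \<notin> set u"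
  shows "a u = \<one>"
proof -
  let ?v = "map (codegen i) u"
  have l: "last u < q" using u n by (rule last_multi_index_less)
  have ne: "u \<noteq> []" using u n by (auto simp: multi_indices_def)
  have face: "K_face G n q i a = \<one>\<^bsub>K_group G n (q - 1)\<^esub>"
    using a i l by (auto simp: moore_group_def kernel_def)
  \<comment> \<open>\<open>codegen i\<close> identifies only \<open>i\<close> and
    \<open>i + 1\<close>, and \<open>i\<close> is not in \<open>u\<close>.\<close>
  have "sorted_wrt (<) ?v"
    unfolding sorted_wrt_map
  proof (rule sorted_wrt_mono_rel[rotated])
    show "sorted_wrt (<) u" using u by (simp add: multi_indices_def)
    show "codegen i x < codegen i y" if "x \<in> set u" "y \<in> set u" "x < y" for x y
      using that i by (cases "y = Suc i"; cases "x = i") (auto simp: codegen_def)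
  qed
  then have v: "?v \<in> multi_indices n (q - 1)"
    using u i l by (fastforce simp: multi_indices_def codegen_def)
  have "map (coface i) ?v = u"
    using i by (auto simp: comp_def intro!: map_idI coface_codegen)
  \<comment> \<open>Since \<open>last u > i\<close>, \<open>last ?v \<ge> i\<close>; hence the
    regular case of \<open>K_face\<close> applies and reads off \<open>a u\<close>.\<close>
  moreover have "last ?v + 1 \<noteq> i" using ne i by (simp add: last_map codegen_def)
  ultimately have "K_face G n q i a ?v = a u" using v by (simp add: K_face_def del: map_map)
  then show ?thesis using face v by (simp add: K_group_def)
qed

lemma moore_group_K_trivial:
  assumes n: "n \<ge> 1" and q: "q \<noteq> n"
  shows "carrier (moore_group (K_group G n) (K_face G n) q) = {\<one>\<^bsub>K_group G n q\<^esub>}"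
proof -
  interpret S: simplicial_group "K_group G n" "K_face G n" "K_degen G n"
    using n by (rule simplicial_group_K)
  have "a = \<one>\<^bsub>K_group G n q\<^esub>"
    if a: "a \<in> carrier (moore_group (K_group G n) (K_face G n) q)" for a
  proof -
    have aK: "a \<in> carrier (K_group G n q)" using a by (simp add: moore_group_def)
    have "a u = \<one>" if u: "u \<in> multi_indices n q" for u
    proof (cases "\<exists>i < last u. i \<notin> set u")
      case True
      then show ?thesis using moore_entry_one[OF a u n] by blast
    next
      case False
      let ?i = "last u + 1"
      have ne: "u \<noteq> []" and su: "sorted_wrt (<) u" and len: "length u = n"
        using u n by (auto simp: multi_indices_def)
      have lq: "last u < q" using u n by (rule last_multi_index_less)
      have le: "x \<le> last u" if "x \<in> set u" for x using u that by (rule multi_index_le_last)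
      \<comment> \<open>Without gaps \<open>last u = n - 1\<close>, so \<open>?i = n\<close>, and
        \<open>q \<noteq> n\<close> makes \<open>?i\<close> one of the faces that vanish on the
        Moore group.\<close>
      have "set u = {..last u}"
        using False le ne by (auto simp: le_less)
      then have "n = last u + 1"
        using len su distinct_card[of u] by (simp add: strict_sorted_iff)
      then have iq: "?i < q" using q lq by simp
      have ui: "u @ [?i] \<in> multi_indices (Suc n) q"
        using u iq le by (auto simp: multi_indices_def sorted_wrt_append less_Suc_eq_le)
      have uq: "u \<in> multi_indices n (q - 1)"
        using u le iq by (fastforce simp: multi_indices_def)
      \<comment> \<open>Deleting \<open>u ! k\<close> opens a gap below the last entry
        \<open>?i\<close>, so the previous lemma kills every correction factor in the exceptional
        face formula, leaving just \<open>a u\<close>.\<close>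
      have one: "a (delete_nth k (u @ [?i])) = \<one>" if k: "k < n" for k
      proof (rule moore_entry_one[OF a _ n])
        show "delete_nth k (u @ [?i]) \<in> multi_indices n q"
          using ui k set_delete_nth_subset[of k "u @ [?i]"]
          by (auto simp: multi_indices_def length_delete_nth sorted_wrt_delete_nth)
        show "u ! k < last (delete_nth k (u @ [?i]))"
          using k len le by (simp add: delete_nth_append less_Suc_eq_le)
        have "(u @ [?i]) ! k \<notin> set (delete_nth k (u @ [?i]))"
          using ui k len by (intro nth_notin_delete_nth) (auto simp: multi_indices_def strict_sorted_iff)
        then show "u ! k \<notin> set (delete_nth k (u @ [?i]))"
          using k len by (simp add: nth_append)
      qed
      have "K_face G n q ?i a u = \<one>"
        using a iq uq by (auto simp: moore_group_def kernel_def K_group_def)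
      moreover have "K_face G n q ?i a u = a u \<otimes> (\<Otimes>j\<in>{..<n}. \<one>)"
        using uq one by (simp add: K_face_def int_pow_one cong: finprod_cong)
      moreover have "a u \<in> carrier G" using aK u by (auto simp: K_group_def)
      ultimately show ?thesis by simp
    qed
    then show ?thesis using aK by (auto simp: K_group_def PiE_def extensional_def)
  qed
  moreover have "\<one>\<^bsub>K_group G n q\<^esub> \<in> carrier (moore_group (K_group G n) (K_face G n) q)"
    using group.is_monoid[OF group_K_group]
    by (auto simp: S.moore_group_carrier monoid.one_closed group_hom.hom_one[OF S.face_group_hom])
  ultimately show ?thesis by blast
qed

section \<open>Homotopy groups\<close>

lemma moore_boundaries_K:
  assumes n: "n \<ge> 1"
  shows "moore_boundaries (K_group G n) (K_face G n) n = {\<one>\<^bsub>K_group G n n\<^esub>}"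
proof -
  interpret S: simplicial_group "K_group G n" "K_face G n" "K_degen G n"
    using n by (rule simplicial_group_K)
  show ?thesis
    using group_hom.hom_one[OF S.face_group_hom, of "n + 1" "n + 1"] moore_group_K_trivial[OF n, of "n + 1"]
    by (simp add: moore_boundaries_def)
qed

text \<open>All faces out of degree \<open>n\<close> land in degree \<open>n - 1\<close>, where
  there are no multi-indices and the group is trivial.\<close>

lemma moore_cycles_K:
  assumes n: "n \<ge> 1"
  shows "moore_cycles (K_group G n) (K_face G n) n = carrier (K_group G n n)"
proof -
  interpret S: simplicial_group "K_group G n" "K_face G n" "K_degen G n"
    using n by (rule simplicial_group_K)
  have "y = \<one>\<^bsub>K_group G n (n - 1)\<^esub>" if "y \<in> carrier (K_group G n (n - 1))" for y
    using that n by (auto simp: K_group_def multi_indices_empty)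
  then show ?thesis
    using group_hom.hom_closed[OF S.face_group_hom] by (auto simp: S.moore_cycles_eq)
qed

lemma homotopy_group_K_trivial:
  assumes n: "n \<ge> 1" and m: "m \<noteq> n"
  shows "trivial_group (homotopy_group (K_group G n) (K_face G n) m)"
proof -
  interpret S: simplicial_group "K_group G n" "K_face G n" "K_degen G n"
    using n by (rule simplicial_group_K)
  let ?H = "homotopy_group (K_group G n) (K_face G n) m"
  interpret H: group ?H by (rule S.group_homotopy_group)
  have "moore_cycles (K_group G n) (K_face G n) m \<subseteq> {\<one>\<^bsub>K_group G n m\<^esub>}"
    using moore_group_K_trivial[OF n m]
    by (auto simp: moore_cycles_def kernel_def)
  \<comment> \<open>Each element of the quotient is a coset represented by a cycle, and the only
    possible representative is the identity.\<close>
  then have "x = y" if "x \<in> carrier ?H" "y \<in> carrier ?H" for x y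
    using that by (auto simp: homotopy_group_def FactGroup_def RCOSETS_def)
  then have "carrier ?H = {\<one>\<^bsub>?H\<^esub>}" using H.one_closed by blast
  then show ?thesis by (simp add: trivial_group_def H.is_group)
qed

lemma homotopy_group_K_iso:
  assumes n: "n \<ge> 1"
  shows "homotopy_group (K_group G n) (K_face G n) n \<cong> G"
proof -
  interpret K: group "K_group G n n" by (rule group_K_group)
  let ?h = "\<lambda>a :: nat list \<Rightarrow> 'a. a [0..<n]"
  have mem: "[0..<n] \<in> multi_indices n n" by (simp add: multi_indices_self)
  have "?h \<in> hom (K_group G n n) G"
    using mem by (auto simp: hom_def K_group_def)
  then interpret h: group_hom "K_group G n n" G ?h
    by (simp add: group_hom_def group_hom_axioms_def K.is_group is_group)
  have "x \<in> ?h ` carrier (K_group G n n)" if "x \<in> carrier G" for x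
    using that mem by (intro image_eqI[of _ _ "\<lambda>_\<in>multi_indices n n. x"]) (auto simp: K_group_def)
  then have "?h ` carrier (K_group G n n) = carrier G" by auto
  \<comment> \<open>Evaluation at the only index is injective, so its kernel coincides with the
    boundaries; the first isomorphism theorem then has exactly the quotient defining the homotopy
    group.\<close>
  then have iso: "K_group G n n Mod kernel (K_group G n n) G ?h \<cong> G"
    using h.FactGroup_iso by simp
  have "x = \<one>\<^bsub>K_group G n n\<^esub>" if "x \<in> kernel (K_group G n n) G ?h" for x
    using that by (auto simp: kernel_def K_group_def multi_indices_self PiE_def extensional_def)
  then have "kernel (K_group G n n) G ?h = {\<one>\<^bsub>K_group G n n\<^esub>}"
    by (auto simp: kernel_def)
  then show ?thesis
    using iso moore_cycles_K[OF n] moore_boundaries_K[OF n]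
    by (simp add: homotopy_group_def moore_group_def)
qed

end

theorem theorem3p1:
  fixes A :: "('a, 'b) monoid_scheme" and n :: nat
  assumes "comm_group A" and "n \<ge> 1"
  shows "EM_simplicial_group A n (K_group A n) (K_face A n) (K_degen A n)"
  unfolding EM_simplicial_group_def
  using comm_group.simplicial_group_K[OF assms] comm_group.homotopy_group_K_iso[OF assms]
    comm_group.homotopy_group_K_trivial[OF assms] by blast

end
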